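(* Let $(\mathcal{H},d)$ be an Hadamard space, let $F\colon\mathcal{H}\to\mathcal{H}$ be a nonexpansive mapping with at least one fixed point, let $(T_t)_{t\ge0}$ be the nonlinear semigroup generated by $F$, i.e. $T_tx=\lim_{n\to\infty}(R_{t/n})^nx$ for $x\in\mathcal{H}$, where $R_\lambda$ denotes the resolvent of $F$, and let $x_0\in\mathcal{H}$. Then $T_tx_0$ converges weakly to a fixed point of $F$ as $t\to\infty$.
   Context: An Hadamard space $(\mathcal{H},d)$ is a complete geodesic metric space satisfying $$d(x,\gamma_t)^2\le(1-t)d(x,\gamma_0)^2+t\,d(x,\gamma_1)^2-t(1-t)d(\gamma_0,\gamma_1)^2$$ for any $x\in\mathcal{H}$, any geodesic $\gamma\colon[0,1]\to\mathcal{H}$ and any $t\in[0,1]$. Any two points $x,y\in\mathcal{H}$ are joined by a unique geodesic, and for $t\in[0,1]$ one writes $(1-t)x+ty$ for the point $z$ on this geodesic with $d(x,z)=t\,d(x,y)$ and $d(z,y)=(1-t)d(x,y)$. A mapping $F\colon\mathcal{H}\to\mathcal{H}$ is nonexpansive if $d(Fx,Fy)\le d(x,y)$ for all $x,y\in\mathcal{H}$. Resolvent: for $x\in\mathcal{H}$ and $\lambda>0$, the mapping $G_{x,\lambda}\colon\mathcal{H}\to\mathcal{H}$, $G_{x,\lambda}(y)=\frac{1}{1+\lambda}x+\frac{\lambda}{1+\lambda}Fy$, is a strict contraction with Lipschitz constant $\frac{\lambda}{1+\lambda}$, and $R_\lambda x$ denotes its unique fixed point; $R_0x=x$. Semigroup: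 it is known that the limit $T_tx:=\lim_{n\to\infty}(R_{t/n})^nx$ exists for every $x\in\mathcal{H}$ and $t\ge0$, uniformly with respect to $t$ on each bounded subinterval of $[0,\infty)$, and that $(T_t)_{t\ge0}$ is a strongly continuous semigroup of nonexpansive mappings. Weak convergence: for a bounded sequence $(x_n)\subset\mathcal{H}$, the function $x\mapsto\limsup_{n\to\infty}d(x,x_n)^2$ on $\mathcal{H}$ has a unique minimizer, called the asymptotic center of $(x_n)$. A bounded sequence $(x_n)$ converges weakly to $x\in\mathcal{H}$ if $x$ is the asymptotic center of each subsequence of $(x_n)$. "$T_tx_0$ converges weakly to $z$ as $t\to\infty$" means that $(T_{t_n}x_0)$ converges weakly to $z$ for every sequence $t_n\to\infty$. *)

theory Defs
  imports "HOL-Analysis.Analysis"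
begin

text \<open>Geodesics are parametrised on \<open>[0,1]\<close> proportionally to arc length; the values of
  \<open>\<gamma>\<close> outside \<open>[0,1]\<close> are irrelevant.\<close>

definition (in metric_space) geodesic :: "(real \<Rightarrow> 'a) \<Rightarrow> bool" where
  "geodesic \<gamma> \<longleftrightarrow> (\<forall>s\<in>{0..1}. \<forall>t\<in>{0..1}. dist (\<gamma> s) (\<gamma> t) = \<bar>s - t\<bar> * dist (\<gamma> 0) (\<gamma> 1))"

class hadamard_space = complete_space +
  assumes geodesic_exists: "\<exists>\<gamma>. geodesic \<gamma> \<and> \<gamma> 0 = x \<and> \<gamma> 1 = y"
    and geodesic_ineq: "geodesic \<gamma> \<Longrightarrow> 0 \<le> t \<Longrightarrow> t \<le> 1 \<Longrightarrow>
      (dist x (\<gamma> t))\<^sup>2 \<le> (1 - t) * (dist x (\<gamma> 0))\<^sup>2 + t * (dist x (\<gamma> 1))\<^sup>2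
        - t * (1 - t) * (dist (\<gamma> 0) (\<gamma> 1))\<^sup>2"

text \<open>\<open>geo_comb t x y\<close> is the point written \<open>(1 - t) x + t y\<close>, for \<open>0 \<le> t \<le> 1\<close>.\<close>

definition geo_comb :: "real \<Rightarrow> 'a::hadamard_space \<Rightarrow> 'a \<Rightarrow> 'a" where
  "geo_comb t x y = (THE z. \<exists>\<gamma>. geodesic \<gamma> \<and> \<gamma> 0 = x \<and> \<gamma> 1 = y \<and> z \<in> \<gamma> ` {0..1} \<and>
     dist x z = t * dist x y \<and> dist z y = (1 - t) * dist x y)"

text \<open>The description in \<open>geo_comb\<close> determines exactly one point.\<close>

lemma hadamard_dist_unique:
  fixes x y z w :: "'a::hadamard_space"
  assumes "0 \<le> t" "t \<le> 1"
    and z: "dist x z = t * dist x y" "dist z y = (1 - t) * dist x y"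
    and w: "dist x w = t * dist x y" "dist w y = (1 - t) * dist x y"
  shows "z = w"
proof -
  obtain \<gamma> where g: "geodesic \<gamma>" "\<gamma> 0 = x" "\<gamma> 1 = y"
    using geodesic_exists by blast
  have *: "v = \<gamma> t" if "dist x v = t * dist x y" "dist v y = (1 - t) * dist x y" for v
  proof -
    have "(dist v (\<gamma> t))\<^sup>2 \<le> (1 - t) * (dist v x)\<^sup>2 + t * (dist v y)\<^sup>2 - t * (1 - t) * (dist x y)\<^sup>2"
      using geodesic_ineq[OF g(1) assms(1,2), of v] g by simp
    also have "\<dots> = 0"
      unfolding dist_commute[of v x] that power2_eq_square by algebra
    finally show ?thesis by simp
  qed
  from *[OF z] *[OF w] show ?thesis by simp
qed

lemma geo_comb_geodesic:
  fixes \<gamma> :: "real \<Rightarrow> 'a::hadamard_space"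
  assumes "geodesic \<gamma>" "0 \<le> t" "t \<le> 1"
  shows "geo_comb t (\<gamma> 0) (\<gamma> 1) = \<gamma> t"
proof -
  have d: "dist (\<gamma> 0) (\<gamma> t) = t * dist (\<gamma> 0) (\<gamma> 1)" "dist (\<gamma> t) (\<gamma> 1) = (1 - t) * dist (\<gamma> 0) (\<gamma> 1)"
  proof -
    have "dist (\<gamma> s) (\<gamma> r) = \<bar>s - r\<bar> * dist (\<gamma> 0) (\<gamma> 1)" if "s \<in> {0..1}" "r \<in> {0..1}" for s r
      using assms(1) that unfolding geodesic_def by blast
    from this[of 0 t] this[of t 1]
    show "dist (\<gamma> 0) (\<gamma> t) = t * dist (\<gamma> 0) (\<gamma> 1)" "dist (\<gamma> t) (\<gamma> 1) = (1 - t) * dist (\<gamma> 0) (\<gamma> 1)"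
      using assms by simp_all
  qed
  show ?thesis
    unfolding geo_comb_def
  proof (rule the_equality)
    show "\<exists>\<gamma>'. geodesic \<gamma>' \<and> \<gamma>' 0 = \<gamma> 0 \<and> \<gamma>' 1 = \<gamma> 1 \<and> \<gamma> t \<in> \<gamma>' ` {0..1} \<and>
       dist (\<gamma> 0) (\<gamma> t) = t * dist (\<gamma> 0) (\<gamma> 1) \<and> dist (\<gamma> t) (\<gamma> 1) = (1 - t) * dist (\<gamma> 0) (\<gamma> 1)"
      using d assms by (intro exI[of _ \<gamma>]) auto
  qed (use hadamard_dist_unique[OF assms(2,3)] d in blast)
qed

text \<open>The \<open>THE\<close> picks the fixed point of the contraction \<open>y \<mapsto> (1/(1+r)) x + (r/(1+r)) F y\<close>; only \<open>r \<ge> 0\<close> is meant.\<close>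

definition resolvent :: "('a::hadamard_space \<Rightarrow> 'a) \<Rightarrow> real \<Rightarrow> 'a \<Rightarrow> 'a" where
  "resolvent F r x =
     (if r = 0 then x else (THE y. geo_comb (r / (1 + r)) x (F y) = y))"

definition semigroup_gen :: "('a::hadamard_space \<Rightarrow> 'a) \<Rightarrow> real \<Rightarrow> 'a \<Rightarrow> 'a" where
  "semigroup_gen F t x = lim (\<lambda>n. (resolvent F (t / real n) ^^ n) x)"

text \<open>The \<open>limsup\<close> is taken in the extended reals; it is finite for bounded sequences.\<close>

definition asym_fun :: "(nat \<Rightarrow> 'a::metric_space) \<Rightarrow> 'a \<Rightarrow> ereal" where
  "asym_fun X c = limsup (\<lambda>n. ereal ((dist c (X n))\<^sup>2))"

definition is_asymptotic_center :: "(nat \<Rightarrow> 'a::metric_space) \<Rightarrow> 'a \<Rightarrow> bool" where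
  "is_asymptotic_center X c \<longleftrightarrow> {y. \<forall>w. asym_fun X y \<le> asym_fun X w} = {c}"

definition weakly_converges :: "(nat \<Rightarrow> 'a::metric_space) \<Rightarrow> 'a \<Rightarrow> bool" where
  "weakly_converges X z \<longleftrightarrow>
     bounded (range X) \<and> (\<forall>r. strict_mono r \<longrightarrow> is_asymptotic_center (X \<circ> r) z)"

text \<open>Only the values of \<open>u\<close> on \<open>[0,\<infinity>)\<close> matter.\<close>

definition weakly_converges_at_top :: "(real \<Rightarrow> 'a::metric_space) \<Rightarrow> 'a \<Rightarrow> bool" where
  "weakly_converges_at_top u z \<longleftrightarrow>
     (\<forall>t. (\<forall>n. 0 \<le> t n) \<and> filterlim t at_top sequentially \<longrightarrow> weakly_converges (\<lambda>n. u (t n)) z)"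

end

theory Submission
  imports Defs
begin

text \<open>The resolvent identity and the CN inequality give, for the squared distances of the iterates
  \<open>(R\<^sub>\<rho>)\<^sup>m x\<close> and \<open>(R\<^sub>\<mu>)\<^sup>n x\<close>, a linear recursion with an explicit quadratic solution; this
  yields existence of \<open>T\<^sub>t x\<close> and lets one compare different times without the semigroup law.
  The distances to a fixed point \<open>p\<close> are nonincreasing in \<open>t\<close>, and summing the decrease of
  \<open>d(p, \<cdot>)\<^sup>2\<close> along the iterates gives \<open>t d(T\<^sub>t x, F (T\<^sub>t x))\<^sup>2 \<le> d(p, x)\<^sup>2\<close>. Hence the asymptotic
  center of \<open>(T\<^bsub>t(n)\<^esub> x)\<close>, for any \<open>t(n) \<rightarrow> \<infinity>\<close>, is a fixed point of \<open>F\<close>. On fixed points \<open>p\<close> the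
  function it minimizes is \<open>(lim d(p, T\<^sub>t x))\<^sup>2\<close>, independent of the sequence, so all sequences have
  the same asymptotic center.\<close>

section \<open>Convexity in Hadamard spaces\<close>

lemma geodesic_dist:
  fixes \<gamma> :: "real \<Rightarrow> 'a::metric_space"
  assumes "geodesic \<gamma>" "s \<in> {0..1}" "t \<in> {0..1}"
  shows "dist (\<gamma> s) (\<gamma> t) = \<bar>s - t\<bar> * dist (\<gamma> 0) (\<gamma> 1)"
  using assms unfolding geodesic_def by blast

lemma
  fixes x y :: "'a::hadamard_space"
  assumes t: "0 \<le> t" "t \<le> 1"
  shows dist_geo_comb_left: "dist x (geo_comb t x y) = t * dist x y"
    and dist_geo_comb_right: "dist (geo_comb t x y) y = (1 - t) * dist x y"
    and geo_comb_CN: "(dist a (geo_comb t x y))\<^sup>2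
      \<le> (1 - t) * (dist a x)\<^sup>2 + t * (dist a y)\<^sup>2 - t * (1 - t) * (dist x y)\<^sup>2"
proof -
  obtain \<gamma> where g: "geodesic \<gamma>" "\<gamma> 0 = x" "\<gamma> 1 = y"
    using geodesic_exists by blast
  have e: "geo_comb t x y = \<gamma> t"
    using geo_comb_geodesic[OF g(1) t] g by simp
  show "dist x (geo_comb t x y) = t * dist x y"
    using geodesic_dist[OF g(1), of 0 t] t g e by simp
  show "dist (geo_comb t x y) y = (1 - t) * dist x y"
    using geodesic_dist[OF g(1), of t 1] t g e by simp
  show "(dist a (geo_comb t x y))\<^sup>2
      \<le> (1 - t) * (dist a x)\<^sup>2 + t * (dist a y)\<^sup>2 - t * (1 - t) * (dist x y)\<^sup>2"
    using geodesic_ineq[OF g(1) t, of a] g e by simp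
qed

text \<open>Two distances alone identify the point, so no geodesic has to be exhibited when an
  equality of points is proved.\<close>

lemma geo_comb_eqI:
  fixes x y z :: "'a::hadamard_space"
  assumes "0 \<le> t" "t \<le> 1" "dist x z = t * dist x y" "dist z y = (1 - t) * dist x y"
  shows "geo_comb t x y = z"
  using hadamard_dist_unique[OF assms(1,2) _ _ assms(3,4)]
    dist_geo_comb_left dist_geo_comb_right assms(1,2) by blast

lemma geo_comb_commute:
  fixes x y :: "'a::hadamard_space"
  assumes "0 \<le> t" "t \<le> 1"
  shows "geo_comb (1 - t) y x = geo_comb t x y"
  using assms dist_geo_comb_left[OF assms, of x y] dist_geo_comb_right[OF assms, of x y]
  by (intro geo_comb_eqI) (simp_all add: dist_commute)

text \<open>The CN inequality is used twice: for the geodesic from \<open>x\<close> to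
  \<open>b\<close> seen from \<open>u\<close>, and for the one from \<open>x\<close> to
  \<open>a\<close> seen from \<open>b\<close>. All terms except
  \<open>(t * dist a b)\<^sup>2\<close> cancel.\<close>

lemma dist_geo_comb_same_left:
  fixes x a b :: "'a::hadamard_space"
  assumes t: "0 \<le> t" "t \<le> 1"
  shows "dist (geo_comb t x a) (geo_comb t x b) \<le> t * dist a b"
proof -
  define u where "u = geo_comb t x a"
  have ux: "dist u x = t * dist x a"
    unfolding u_def using dist_geo_comb_left[OF t, of x a] by (simp add: dist_commute)
  have 1: "(dist u (geo_comb t x b))\<^sup>2
      \<le> (1 - t) * (dist u x)\<^sup>2 + t * (dist u b)\<^sup>2 - t * (1 - t) * (dist x b)\<^sup>2"
    by (rule geo_comb_CN[OF t])
  have "(dist u b)\<^sup>2 \<le> (1 - t) * (dist x b)\<^sup>2 + t * (dist a b)\<^sup>2 - t * (1 - t) * (dist x a)\<^sup>2"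
    using geo_comb_CN[OF t, of b x a] unfolding u_def by (simp add: dist_commute)
  from mult_left_mono[OF this t(1)] 1
  have "(dist u (geo_comb t x b))\<^sup>2 \<le> (1 - t) * (dist u x)\<^sup>2
      + t * ((1 - t) * (dist x b)\<^sup>2 + t * (dist a b)\<^sup>2 - t * (1 - t) * (dist x a)\<^sup>2)
      - t * (1 - t) * (dist x b)\<^sup>2"
    by linarith
  also have "\<dots> = (t * dist a b)\<^sup>2"
    unfolding ux by algebra
  finally show ?thesis
    unfolding u_def using t by (auto intro: power2_le_imp_le)
qed

text \<open>The endpoints are moved one at a time; for the left one the geodesic is
  reversed.\<close>

lemma dist_geo_comb_le:
  fixes x x' a a' :: "'a::hadamard_space"
  assumes t: "0 \<le> t" "t \<le> 1"
  shows "dist (geo_comb t x a) (geo_comb t x' a') \<le> (1 - t) * dist x x' + t * dist a a'"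
proof -
  have "dist (geo_comb t x a) (geo_comb t x' a) \<le> (1 - t) * dist x x'"
    using dist_geo_comb_same_left[of "1 - t" a x x'] t by (simp add: geo_comb_commute)
  moreover have "dist (geo_comb t x' a) (geo_comb t x' a') \<le> t * dist a a'"
    by (rule dist_geo_comb_same_left[OF t])
  ultimately show ?thesis
    using dist_triangle[of "geo_comb t x a" "geo_comb t x' a'" "geo_comb t x' a"] by linarith
qed


section \<open>Resolvents and the semigroup\<close>

locale nonexpansive_map =
  fixes F :: "'a::hadamard_space \<Rightarrow> 'a"
  assumes nonexpansive: "dist (F x) (F y) \<le> dist x y"
begin

section \<open>A single resolvent step\<close>

lemma resolvent_0 [simp]: "resolvent F 0 = id"
  by (auto simp: resolvent_def)

text \<open>This makes the \<open>THE\<close> in \<open>resolvent\<close> usable: for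
  \<open>r\<close> nonzero, Banach's theorem gives a unique fixed point, the contraction constant
  being \<open>r / (1 + r)\<close>.\<close>

lemma geo_comb_resolvent:
  assumes r: "0 \<le> r"
  shows "geo_comb (r / (1 + r)) x (F (resolvent F r x)) = resolvent F r x"
proof (cases "r = 0")
  case True
  then show ?thesis
    by (auto intro!: geo_comb_eqI)
next
  case False
  define t where "t = r / (1 + r)"
  have t: "0 \<le> t" "t < 1"
    using r by (auto simp: t_def)
  have "dist (geo_comb t x (F y)) (geo_comb t x (F z)) \<le> t * dist y z" for y z
    using dist_geo_comb_same_left[of t x "F y" "F z"] mult_left_mono[OF nonexpansive[of y z] t(1)] t
    by simp
  then have "\<exists>!y. geo_comb t x (F y) = y"
    by (intro banach_fix_type[OF t]) blast
  from theI'[OF this] show ?thesis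
    using False by (simp add: resolvent_def t_def)
qed

text \<open>The point \<open>y = resolvent F r x\<close> divides the geodesic from \<open>x\<close>
  to \<open>F y\<close> in the ratio \<open>r : 1\<close>. With \<open>dist y (F y)\<close> as unit
  of length this needs no division and covers \<open>r = 0\<close>.\<close>

lemma
  assumes r: "0 \<le> r"
  shows dist_resolvent: "dist x (resolvent F r x) = r * dist (resolvent F r x) (F (resolvent F r x))"
    and dist_F_resolvent:
      "dist x (F (resolvent F r x)) = (1 + r) * dist (resolvent F r x) (F (resolvent F r x))"
proof -
  define y where "y = resolvent F r x"
  have y: "geo_comb (r / (1 + r)) x (F y) = y"
    using geo_comb_resolvent[OF r, of x] by (simp add: y_def)
  have t: "0 \<le> r / (1 + r)" "r / (1 + r) \<le> 1" "1 - r / (1 + r) = 1 / (1 + r)"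
    using r by (auto simp: field_simps)
  have 1: "dist x y = r / (1 + r) * dist x (F y)" "dist y (F y) = 1 / (1 + r) * dist x (F y)"
    using dist_geo_comb_left[OF t(1,2), of x "F y"] dist_geo_comb_right[OF t(1,2), of x "F y"] y t(3)
    by simp_all
  have 2: "dist x (F y) = (1 + r) * dist y (F y)"
    using 1(2) r by simp
  then show "dist x (F (resolvent F r x)) = (1 + r) * dist (resolvent F r x) (F (resolvent F r x))"
    by (simp add: y_def)
  show "dist x (resolvent F r x) = r * dist (resolvent F r x) (F (resolvent F r x))"
    using 1(1) r unfolding 2 by (simp add: y_def)
qed

text \<open>Converse of the preceding distance formulas: they place \<open>y\<close> on the geodesic
  from \<open>x\<close> to \<open>F y\<close> at parameter \<open>r / (1 + r)\<close>, so
  \<open>y\<close> is a fixed point of the same contraction as the resolvent.\<close>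

lemma resolvent_eqI:
  assumes r: "0 \<le> r"
    and y: "dist x y = r * dist y (F y)" "dist x (F y) = (1 + r) * dist y (F y)"
  shows "resolvent F r x = y"
proof -
  define z where "z = resolvent F r x"
  define t where "t = r / (1 + r)"
  have t: "0 \<le> t" "t < 1" "t * (1 + r) = r" "(1 - t) * (1 + r) = 1"
    using r by (auto simp: t_def field_simps)
  have "geo_comb t x (F y) = y"
  proof (rule geo_comb_eqI)
    show "dist x y = t * dist x (F y)"
      unfolding y mult.assoc[symmetric] t ..
    show "dist y (F y) = (1 - t) * dist x (F y)"
      unfolding y mult.assoc[symmetric] t by simp
  qed (use t in auto)
  moreover have "geo_comb t x (F z) = z"
    using geo_comb_resolvent[OF r] by (simp add: z_def t_def)
  ultimately have "dist z y \<le> t * dist (F z) (F y)"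
    using dist_geo_comb_same_left[of t x "F z" "F y"] t by simp
  also have "\<dots> \<le> t * dist z y"
    by (intro mult_left_mono nonexpansive t)
  finally have "(1 - t) * dist z y \<le> 0"
    by (simp add: algebra_simps)
  then show ?thesis
    using t by (simp add: z_def mult_le_0_iff)
qed

lemma resolvent_nonexpansive:
  assumes r: "0 \<le> r"
  shows "dist (resolvent F r x) (resolvent F r x') \<le> dist x x'"
proof -
  define t where "t = r / (1 + r)"
  have t: "0 \<le> t" "t < 1"
    using r by (auto simp: t_def)
  let ?y = "resolvent F r x" and ?y' = "resolvent F r x'"
  have "dist ?y ?y' = dist (geo_comb t x (F ?y)) (geo_comb t x' (F ?y'))"
    unfolding t_def by (simp add: geo_comb_resolvent r)
  also have "\<dots> \<le> (1 - t) * dist x x' + t * dist (F ?y) (F ?y')"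
    using t by (intro dist_geo_comb_le) auto
  also have "\<dots> \<le> (1 - t) * dist x x' + t * dist ?y ?y'"
    by (intro add_left_mono mult_left_mono nonexpansive t)
  finally have "(1 - t) * dist ?y ?y' \<le> (1 - t) * dist x x'"
    by (simp add: algebra_simps)
  then show ?thesis
    using t by simp
qed

text \<open>In the triangle inequality through \<open>F x\<close>, the term
  \<open>dist (F x) (F ?y)\<close> is at most \<open>dist x ?y\<close>, which is \<open>r\<close>
  displacements of \<open>?y\<close> and cancels.\<close>

lemma dist_F_resolvent_le:
  assumes r: "0 \<le> r"
  shows "dist (resolvent F r x) (F (resolvent F r x)) \<le> dist x (F x)"
proof -
  let ?y = "resolvent F r x"
  have "(1 + r) * dist ?y (F ?y) \<le> dist x (F x) + dist (F x) (F ?y)"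
    using dist_triangle[of x "F ?y" "F x"] dist_F_resolvent[OF r, of x] by simp
  also have "\<dots> \<le> dist x (F x) + r * dist ?y (F ?y)"
    using nonexpansive[of x ?y] dist_resolvent[OF r, of x] by simp
  finally show ?thesis
    by (simp add: algebra_simps)
qed

lemma resolvent_fixed_point:
  assumes "0 \<le> r" "F p = p"
  shows "resolvent F r p = p"
  using assms by (intro resolvent_eqI) auto

text \<open>CN at \<open>p\<close> on the geodesic from \<open>x\<close> to \<open>F y\<close>, with
  \<open>dist p (F y)\<close> bounded by \<open>dist p y\<close>; the negative CN term is the source
  of the decrease, which is summed over the iterates later.\<close>

lemma dist_fixed_point_resolvent:
  assumes r: "0 \<le> r" and p: "F p = p"
  shows "(dist p (resolvent F r x))\<^sup>2
    \<le> (dist p x)\<^sup>2 - r * (dist (resolvent F r x) (F (resolvent F r x)))\<^sup>2"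
proof -
  define y where "y = resolvent F r x"
  define t where "t = r / (1 + r)"
  define D where "D = (dist y (F y))\<^sup>2"
  have t: "0 \<le> t" "t < 1" "t * (1 + r) = r" "(1 - t) * (1 + r) = 1"
    using r by (auto simp: t_def field_simps)
  have "dist p (F y) \<le> dist p y"
    using nonexpansive[of p y] p by simp
  then have "(dist p (F y))\<^sup>2 \<le> (dist p y)\<^sup>2"
    by (intro power_mono) auto
  moreover have "(dist p y)\<^sup>2
      \<le> (1 - t) * (dist p x)\<^sup>2 + t * (dist p (F y))\<^sup>2 - t * (1 - t) * (dist x (F y))\<^sup>2"
    using geo_comb_CN[of t p x "F y"] geo_comb_resolvent[OF r, of x] t by (simp add: y_def t_def)
  moreover have "t * (1 - t) * (dist x (F y))\<^sup>2 = r * D"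
  proof -
    have "dist x (F y) = (1 + r) * dist y (F y)"
      using dist_F_resolvent[OF r, of x] by (simp add: y_def)
    then have "t * (1 - t) * (dist x (F y))\<^sup>2 = (t * (1 + r)) * ((1 - t) * (1 + r)) * D"
      unfolding D_def by algebra
    then show ?thesis
      using t by simp
  qed
  ultimately have "(dist p y)\<^sup>2 \<le> (1 - t) * (dist p x)\<^sup>2 + t * (dist p y)\<^sup>2 - r * D"
    using mult_left_mono[of "(dist p (F y))\<^sup>2" "(dist p y)\<^sup>2" t] t(1) by linarith
  then have "(1 - t) * (dist p y)\<^sup>2 \<le> (1 - t) * (dist p x)\<^sup>2 - r * D"
    by (simp add: algebra_simps)
  \<comment> \<open>Dividing by \<open>1 - t\<close> directly would give the larger decrease
    \<open>r * (1 + r) * D\<close>; the weaker \<open>r * D\<close> suffices.\<close>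
  moreover have "(1 - t) * (r * D) \<le> 1 * (r * D)"
    using t r by (intro mult_right_mono) (auto simp: D_def)
  ultimately have "(1 - t) * (dist p y)\<^sup>2 \<le> (1 - t) * ((dist p x)\<^sup>2 - r * D)"
    by (simp add: algebra_simps)
  then show ?thesis
    using t unfolding y_def D_def by simp
qed

text \<open>The points \<open>x\<close>, \<open>w\<close>, \<open>y\<close>, \<open>F y\<close> lie
  in this order on one geodesic. Two triangle inequalities pin down \<open>dist w (F y)\<close>, so
  \<open>y\<close> divides the geodesic from \<open>w\<close> to \<open>F y\<close> in the ratio
  required for step \<open>\<mu>\<close>.\<close>

lemma resolvent_identity:
  assumes \<mu>: "0 \<le> \<mu>" "\<mu> \<le> \<rho>" "0 < \<rho>"
  shows "resolvent F \<mu> (geo_comb (\<mu> / \<rho>) (resolvent F \<rho> x) x) = resolvent F \<rho> x"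
proof -
  define y where "y = resolvent F \<rho> x"
  define w where "w = geo_comb (\<mu> / \<rho>) y x"
  have a: "0 \<le> \<mu> / \<rho>" "\<mu> / \<rho> \<le> 1"
    using \<mu> by auto
  have xy: "dist y x = \<rho> * dist y (F y)" and xF: "dist x (F y) = (1 + \<rho>) * dist y (F y)"
    using dist_resolvent[of \<rho> x] dist_F_resolvent[of \<rho> x] \<mu> by (auto simp: y_def dist_commute)
  have wy: "dist w y = \<mu> * dist y (F y)"
    using dist_geo_comb_left[OF a, of y x] \<mu> xy by (simp add: w_def dist_commute)
  have wx: "dist x w = (\<rho> - \<mu>) * dist y (F y)"
  proof -
    have "(1 - \<mu> / \<rho>) * \<rho> = \<rho> - \<mu>"
      using \<mu> by (simp add: left_diff_distrib)
    then show ?thesis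
      using dist_geo_comb_right[OF a, of y x] unfolding xy mult.assoc[symmetric]
      by (simp add: w_def dist_commute)
  qed
  have "dist w (F y) \<le> (1 + \<mu>) * dist y (F y)"
    using dist_triangle[of w "F y" y] wy by (simp add: algebra_simps)
  moreover have "(1 + \<mu>) * dist y (F y) \<le> dist w (F y)"
    using dist_triangle[of x "F y" w] wx xF by (simp add: algebra_simps)
  ultimately show ?thesis
    using wy \<mu> unfolding w_def y_def by (intro resolvent_eqI) auto
qed

section \<open>Iterated resolvents with different step sizes\<close>

lemma resolvent_funpow_nonexpansive:
  assumes "0 \<le> r"
  shows "dist ((resolvent F r ^^ n) x) ((resolvent F r ^^ n) y) \<le> dist x y"
  by (induction n) (auto intro: order_trans[OF resolvent_nonexpansive[OF assms]])

lemma dist_funpow_resolvent: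
  assumes r: "0 \<le> r"
  shows "dist x ((resolvent F r ^^ n) x) \<le> real n * r * dist x (F x)"
proof (induction n)
  case (Suc n)
  have "dist x (resolvent F r x) \<le> r * dist x (F x)"
    using dist_resolvent[OF r, of x] mult_left_mono[OF dist_F_resolvent_le[OF r, of x] r] by simp
  moreover have "dist (resolvent F r x) ((resolvent F r ^^ Suc n) x) \<le> dist x ((resolvent F r ^^ n) x)"
    by (simp add: resolvent_nonexpansive r)
  ultimately show ?case
    using Suc dist_triangle[of x "(resolvent F r ^^ Suc n) x" "resolvent F r x"]
    by (simp add: algebra_simps)
qed simp

text \<open>The right-hand side is \<open>c m n = (m \<rho> - n \<mu>)\<^sup>2 + n \<mu> (\<rho> - \<mu>)\<close>, the solution of the recursion
  \<open>c m n = (1 - \<alpha>) c m (n - 1) + \<alpha> c (m - 1) (n - 1)\<close>, \<open>\<alpha> = \<mu> / \<rho>\<close>, which the resolvent identity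
  imposes on squared distances.\<close>

lemma dist_resolvent_funpow_ordered:
  assumes \<mu>: "0 \<le> \<mu>" "\<mu> \<le> \<rho>" "0 < \<rho>"
  shows "(dist ((resolvent F \<rho> ^^ m) x) ((resolvent F \<mu> ^^ n) x))\<^sup>2
    \<le> (dist x (F x))\<^sup>2 * ((real m * \<rho> - real n * \<mu>)\<^sup>2 + real n * \<mu> * (\<rho> - \<mu>))"
proof (induction n arbitrary: m)
  case 0
  have "(dist ((resolvent F \<rho> ^^ m) x) x)\<^sup>2 \<le> (real m * \<rho> * dist x (F x))\<^sup>2"
    using dist_funpow_resolvent[of \<rho> x m] \<mu> by (intro power_mono) (auto simp: dist_commute)
  then show ?case
    by (simp add: power_mult_distrib mult_ac)
next
  case (Suc n)
  show ?case
  proof (cases m)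
    case 0
    have "(dist x ((resolvent F \<mu> ^^ Suc n) x))\<^sup>2 \<le> (real (Suc n) * \<mu> * dist x (F x))\<^sup>2"
      using dist_funpow_resolvent[of \<mu> x "Suc n"] \<mu> by (intro power_mono) auto
    also have "\<dots> = (dist x (F x))\<^sup>2 * (real (Suc n) * \<mu>)\<^sup>2"
      by (simp only: power_mult_distrib mult_ac)
    \<comment> \<open>The added summand is nonnegative because \<open>\<mu> \<le> \<rho>\<close>;
      this is where the ordering of the step sizes matters at the boundary of the recursion.\<close>
    also have "\<dots> \<le> (dist x (F x))\<^sup>2 * ((real (Suc n) * \<mu>)\<^sup>2 + real (Suc n) * \<mu> * (\<rho> - \<mu>))"
      using \<mu> by (intro mult_left_mono) auto
    finally show ?thesis
      using 0 by simp
  next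
    case (Suc k)
    define K where "K = (dist x (F x))\<^sup>2"
    define \<alpha> where "\<alpha> = \<mu> / \<rho>"
    define v where "v = (resolvent F \<rho> ^^ k) x"
    define b where "b = (resolvent F \<mu> ^^ n) x"
    define y where "y = resolvent F \<rho> v"
    have \<alpha>: "0 \<le> \<alpha>" "\<alpha> \<le> 1" "\<mu> = \<alpha> * \<rho>"
      using \<mu> by (auto simp: \<alpha>_def)
    have y: "y = (resolvent F \<rho> ^^ Suc k) x"
      by (simp add: y_def v_def)
    \<comment> \<open>The resolvent identity writes \<open>y\<close>, a step of size
      \<open>\<rho>\<close> from \<open>v\<close>, as a step of size \<open>\<mu>\<close> from
      \<open>geo_comb \<alpha> y v\<close>; nonexpansiveness then removes the last
      \<open>\<mu>\<close>-step on both sides.\<close>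
    have "dist y (resolvent F \<mu> b) \<le> dist (geo_comb \<alpha> y v) b"
      using resolvent_nonexpansive[OF \<mu>(1), of "geo_comb \<alpha> y v" b] resolvent_identity[OF \<mu>, of v]
      by (simp add: y_def \<alpha>_def)
    then have "(dist y (resolvent F \<mu> b))\<^sup>2 \<le> (dist b (geo_comb \<alpha> y v))\<^sup>2"
      by (intro power_mono) (auto simp: dist_commute)
    also have "\<dots> \<le> (1 - \<alpha>) * (dist b y)\<^sup>2 + \<alpha> * (dist b v)\<^sup>2 - \<alpha> * (1 - \<alpha>) * (dist y v)\<^sup>2"
      by (rule geo_comb_CN[OF \<alpha>(1,2)])
    also have "\<dots> \<le> (1 - \<alpha>) * (dist y b)\<^sup>2 + \<alpha> * (dist v b)\<^sup>2"
      using \<alpha> by (simp add: dist_commute)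
    also have "\<dots> \<le> (1 - \<alpha>) * (K * ((real (Suc k) * \<rho> - real n * \<mu>)\<^sup>2 + real n * \<mu> * (\<rho> - \<mu>)))
        + \<alpha> * (K * ((real k * \<rho> - real n * \<mu>)\<^sup>2 + real n * \<mu> * (\<rho> - \<mu>)))"
      using Suc.IH[of "Suc k"] Suc.IH[of k] \<alpha> unfolding y v_def b_def K_def
      by (intro add_mono mult_left_mono) auto
    also have "\<dots> = K * ((real (Suc k) * \<rho> - real (Suc n) * \<mu>)\<^sup>2 + real (Suc n) * \<mu> * (\<rho> - \<mu>))"
      unfolding \<alpha>(3) of_nat_Suc by algebra
    finally show ?thesis
      using Suc by (simp add: y_def v_def b_def K_def)
  qed
qed

text \<open>A cruder but symmetric bound, so that later uses need not know which step size is
  larger.\<close>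

lemma dist_resolvent_funpow:
  assumes "0 < \<rho>" "0 < \<mu>"
  shows "(dist ((resolvent F \<rho> ^^ m) x) ((resolvent F \<mu> ^^ n) x))\<^sup>2
    \<le> (dist x (F x))\<^sup>2 * ((real m * \<rho> - real n * \<mu>)\<^sup>2 + (real m * \<rho> + real n * \<mu>) * (\<rho> + \<mu>))"
  using assms
proof (induction \<rho> \<mu> arbitrary: m n rule: linorder_wlog)
  case (le a b)
  have "real m * a * (b - a) \<le> (real m * a + real n * b) * (a + b)"
    using le by (intro mult_mono) auto
  then have "(dist x (F x))\<^sup>2 * ((real n * b - real m * a)\<^sup>2 + real m * a * (b - a))
    \<le> (dist x (F x))\<^sup>2 * ((real m * a - real n * b)\<^sup>2 + (real m * a + real n * b) * (a + b))"
    by (intro mult_left_mono add_mono) (auto simp: power2_commute)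
  with dist_resolvent_funpow_ordered[of a b n x m] le show ?case
    by (simp add: dist_commute)
next
  case (sym a b)
  from sym(1)[of n m] sym(2,3) show ?case
    by (simp add: dist_commute power2_commute add.commute)
qed

section \<open>The limit semigroup and its behaviour relative to a fixed point\<close>

lemma semigroup_gen_0 [simp]: "semigroup_gen F 0 x = x"
  by (simp add: semigroup_gen_def)

text \<open>With steps \<open>t / m\<close> and \<open>t / n\<close> both iterates reach time
  \<open>t\<close>, so the squared time difference vanishes and only the term proportional to the
  sum of the step sizes remains. It tends to 0, giving a Cauchy sequence.\<close>

lemma LIMSEQ_semigroup_gen:
  assumes t: "0 \<le> t"
  shows "(\<lambda>n. (resolvent F (t / real n) ^^ n) x) \<longlonglongrightarrow> semigroup_gen F t x"
proof (cases "t = 0")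
  case False
  let ?X = "\<lambda>n. (resolvent F (t / real n) ^^ n) x"
  define K where "K = dist x (F x)"
  have "Cauchy ?X"
  proof (rule metric_CauchyI)
    fix e :: real assume e: "0 < e"
    have "(\<lambda>n. K\<^sup>2 * (2 * t * (t / real n + t / real n))) \<longlonglongrightarrow> K\<^sup>2 * (2 * t * (0 + 0))"
      by (intro tendsto_intros lim_const_over_n)
    then have "eventually (\<lambda>n. K\<^sup>2 * (2 * t * (t / real n + t / real n)) < e\<^sup>2) sequentially"
      using e by (intro order_tendstoD(2)) auto
    then obtain N0 where N0: "\<And>n. n \<ge> N0 \<Longrightarrow> K\<^sup>2 * (2 * t * (t / real n + t / real n)) < e\<^sup>2"
      unfolding eventually_sequentially by blast
    \<comment> \<open>The \<open>Suc\<close> excludes index 0, where \<open>t / real n\<close> would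
      be 0 and the comparison of positive step sizes would not apply.\<close>
    define N where "N = Suc N0"
    have "dist (?X m) (?X n) < e" if "m \<ge> N" "n \<ge> N" for m n
    proof -
      have pos: "0 < real m" "0 < real n" "0 < real N" "real N \<le> real m" "real N \<le> real n"
        using that by (auto simp: N_def)
      have "(dist (?X m) (?X n))\<^sup>2 \<le> K\<^sup>2 * (2 * t * (t / real m + t / real n))"
        using dist_resolvent_funpow[of "t / real m" "t / real n" m x n] pos t False
        by (simp add: K_def)
      also have "\<dots> \<le> K\<^sup>2 * (2 * t * (t / real N + t / real N))"
        using t pos by (intro mult_left_mono add_mono divide_left_mono) auto
      also have "\<dots> < e\<^sup>2"
        by (rule N0) (simp add: N_def)
      finally show ?thesis
        using e by (auto intro: power2_less_imp_less)
    qed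
    then show "\<exists>M. \<forall>m\<ge>M. \<forall>n\<ge>M. dist (?X m) (?X n) < e"
      by blast
  qed
  then show ?thesis
    unfolding semigroup_gen_def using Cauchy_convergent convergent_LIMSEQ_iff by blast
qed simp

lemma dist_fixed_point_resolvent_funpow:
  assumes "0 \<le> r" "F p = p"
  shows "dist p ((resolvent F r ^^ n) x) \<le> dist p x"
proof -
  have "(resolvent F r ^^ n) p = p"
    using resolvent_fixed_point[OF assms] by (induction n) auto
  then show ?thesis
    using resolvent_funpow_nonexpansive[OF assms(1), of n p x] by simp
qed

text \<open>Among the \<open>n\<close> steps approximating time \<open>t\<close>, an initial block
  approximates time \<open>s\<close>; the remaining steps do not increase the distance to
  \<open>p\<close>.\<close>

lemma dist_fixed_point_semigroup_gen_antimono: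
  assumes s: "0 \<le> s" "s \<le> t" and p: "F p = p"
  shows "dist p (semigroup_gen F t x) \<le> dist p (semigroup_gen F s x)"
proof (cases "s = 0")
  case True
  have "(\<lambda>n. dist p ((resolvent F (t / real n) ^^ n) x)) \<longlonglongrightarrow> dist p (semigroup_gen F t x)"
    using s by (intro tendsto_intros LIMSEQ_semigroup_gen) auto
  moreover have "dist p ((resolvent F (t / real n) ^^ n) x) \<le> dist p x" for n
    using s p by (intro dist_fixed_point_resolvent_funpow) auto
  ultimately show ?thesis
    using True by (auto intro: LIMSEQ_le_const2)
next
  case False
  with s have pos: "0 < s" "0 < t"
    by auto
  define K where "K = dist x (F x)"
  \<comment> \<open>The number of steps of size \<open>t / n\<close> that fit into time
    \<open>s\<close>; the time reached falls short of \<open>s\<close> by at most one step.\<close>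
  define j where "j n = nat \<lfloor>real n * s / t\<rfloor>" for n
  define h where "h n = t / real n" for n
  have hlim: "h \<longlonglongrightarrow> 0"
    unfolding h_def by (rule lim_const_over_n)
  have j: "real (j n) * h n \<le> s" "s - h n \<le> real (j n) * h n" "j n \<le> n" if "0 < n" for n
  proof -
    have *: "real (j n) \<le> real n * s / t" "real n * s / t - 1 \<le> real (j n)"
      unfolding j_def using pos of_nat_floor[of "real n * s / t"] by simp_all
    have n: "0 < real n"
      using that by simp
    have "real n * s / t * h n = s"
      using n pos by (simp add: h_def)
    moreover have "0 \<le> h n"
      using pos by (simp add: h_def)
    ultimately show "real (j n) * h n \<le> s" "s - h n \<le> real (j n) * h n"
      using mult_right_mono[OF *(1), of "h n"] mult_right_mono[OF *(2), of "h n"]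
      by (auto simp: left_diff_distrib)
    have "real n * s / t \<le> real n * 1"
      using s pos n by (simp add: divide_le_eq)
    with * show "j n \<le> n"
      by linarith
  qed
  have jlim: "(\<lambda>n. real (j n) * h n) \<longlonglongrightarrow> s"
  proof (rule tendsto_sandwich[OF _ _ _ tendsto_const])
    show "(\<lambda>n. s - h n) \<longlonglongrightarrow> s"
      using tendsto_diff[OF tendsto_const hlim, of s] by simp
  qed (use j in \<open>auto intro!: eventually_sequentiallyI[of 1]\<close>)
  define Y where "Y n = (resolvent F (h n) ^^ j n) x" for n
  define Z where "Z n = (resolvent F (s / real n) ^^ n) x" for n
  \<comment> \<open>The squared-distance bound between \<open>j n\<close> steps of size
    \<open>h n\<close> and \<open>n\<close> steps of size \<open>s / n\<close>; both the time
    mismatch and the step sizes tend to 0.\<close>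
  define c where "c n = K\<^sup>2 * ((real (j n) * h n - s)\<^sup>2 + (real (j n) * h n + s) * (h n + s / real n))" for n
  have "c \<longlonglongrightarrow> K\<^sup>2 * ((s - s)\<^sup>2 + (s + s) * (0 + 0))"
    unfolding c_def by (intro tendsto_intros jlim hlim lim_const_over_n)
  then have c: "(\<lambda>n. sqrt (c n)) \<longlonglongrightarrow> 0"
    using tendsto_real_sqrt[of c 0] by simp
  have YZ: "dist (Y n) (Z n) \<le> sqrt (c n)" if "0 < n" for n
  proof (rule real_le_rsqrt)
    show "(dist (Y n) (Z n))\<^sup>2 \<le> c n"
      using dist_resolvent_funpow[of "h n" "s / real n" "j n" x n] pos that
      by (simp add: Y_def Z_def c_def K_def h_def)
  qed
  have "(\<lambda>n. dist (Y n) (Z n)) \<longlonglongrightarrow> 0"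
    by (rule tendsto_sandwich[OF _ _ tendsto_const c])
      (use YZ in \<open>auto intro!: eventually_sequentiallyI[of 1]\<close>)
  moreover have Z: "Z \<longlonglongrightarrow> semigroup_gen F s x"
    unfolding Z_def using s(1) by (rule LIMSEQ_semigroup_gen)
  ultimately have R: "(\<lambda>n. dist p (Z n) + dist (Y n) (Z n)) \<longlonglongrightarrow> dist p (semigroup_gen F s x) + 0"
    by (intro tendsto_intros)
  have L: "(\<lambda>n. dist p ((resolvent F (h n) ^^ n) x)) \<longlonglongrightarrow> dist p (semigroup_gen F t x)"
    unfolding h_def using pos by (intro tendsto_intros LIMSEQ_semigroup_gen) auto
  have "dist p ((resolvent F (h n) ^^ n) x) \<le> dist p (Z n) + dist (Y n) (Z n)" if "1 \<le> n" for n
  proof -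
    have "n = (n - j n) + j n"
      using j(3)[of n] that by simp
    then have "(resolvent F (h n) ^^ n) x = (resolvent F (h n) ^^ (n - j n)) (Y n)"
      unfolding Y_def by (metis funpow_add o_apply)
    also have "dist p \<dots> \<le> dist p (Y n)"
      using pos p by (intro dist_fixed_point_resolvent_funpow) (auto simp: h_def)
    finally show ?thesis
      using dist_triangle[of p "Y n" "Z n"] by (simp add: dist_commute)
  qed
  then show ?thesis
    using LIMSEQ_le[OF L R] by auto
qed

lemma dist_fixed_point_semigroup_gen_le:
  assumes "0 \<le> t" "F p = p"
  shows "dist p (semigroup_gen F t x) \<le> dist p x"
  using dist_fixed_point_semigroup_gen_antimono[of 0 t p x] assms by simp

text \<open>Each step lowers \<open>(dist p _)\<^sup>2\<close> by at least \<open>r\<close> times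
  the squared displacement of its result. Displacements do not increase, so all \<open>n\<close>
  decreases are bounded below by the last one.\<close>

lemma dist_F_resolvent_funpow:
  assumes r: "0 \<le> r" and p: "F p = p"
  shows "real n * r * (dist ((resolvent F r ^^ n) x) (F ((resolvent F r ^^ n) x)))\<^sup>2
    \<le> (dist p x)\<^sup>2 - (dist p ((resolvent F r ^^ n) x))\<^sup>2"
proof (induction n)
  case (Suc n)
  define u where "u = (resolvent F r ^^ n) x"
  let ?d = "\<lambda>z. (dist z (F z))\<^sup>2"
  have "?d (resolvent F r u) \<le> ?d u"
    by (intro power_mono dist_F_resolvent_le r) auto
  then have "real n * r * ?d (resolvent F r u) \<le> real n * r * ?d u"
    using r by (intro mult_left_mono) auto
  moreover have "real n * r * ?d u \<le> (dist p x)\<^sup>2 - (dist p u)\<^sup>2"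
    using Suc by (simp add: u_def)
  moreover have "(dist p (resolvent F r u))\<^sup>2 \<le> (dist p u)\<^sup>2 - r * ?d (resolvent F r u)"
    by (rule dist_fixed_point_resolvent[OF r p])
  ultimately show ?case
    by (simp add: u_def algebra_simps)
qed simp

lemma F_continuous: "X \<longlonglongrightarrow> l \<Longrightarrow> (\<lambda>n. F (X n)) \<longlonglongrightarrow> F l"
  unfolding tendsto_dist_iff[of _ l] tendsto_dist_iff[of _ "F l"]
  by (rule tendsto_sandwich[OF _ _ tendsto_const]) (auto simp: nonexpansive)

lemma dist_F_semigroup_gen:
  assumes t: "0 \<le> t" and p: "F p = p"
  shows "t * (dist (semigroup_gen F t x) (F (semigroup_gen F t x)))\<^sup>2 \<le> (dist p x)\<^sup>2"
proof -
  let ?X = "\<lambda>n. (resolvent F (t / real n) ^^ n) x"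
  have "(\<lambda>n. t * (dist (?X n) (F (?X n)))\<^sup>2)
      \<longlonglongrightarrow> t * (dist (semigroup_gen F t x) (F (semigroup_gen F t x)))\<^sup>2"
    by (intro tendsto_intros F_continuous LIMSEQ_semigroup_gen t)
  \<comment> \<open>For \<open>n\<close> at least 1 the total time \<open>n * (t / n)\<close> equals
    \<open>t\<close>; at 0 the quotient would give total time 0.\<close>
  moreover have "t * (dist (?X n) (F (?X n)))\<^sup>2 \<le> (dist p x)\<^sup>2" if "1 \<le> n" for n
    using dist_F_resolvent_funpow[of "t / real n" p n x] t p that
      zero_le_power2[of "dist p (?X n)"] by (auto simp del: zero_le_power2 intro: order_trans)
  ultimately show ?thesis
    by (intro LIMSEQ_le_const2) auto
qed

end


section \<open>Asymptotic centers\<close>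

text \<open>With \<open>asym_fun_less_eventually\<close>, this replaces extended-real limsups by
  eventual real inequalities with a slack.\<close>

lemma asym_fun_le:
  assumes "\<And>e. 0 < e \<Longrightarrow> eventually (\<lambda>n. (dist c (X n))\<^sup>2 \<le> a + e) sequentially"
  shows "asym_fun X c \<le> ereal a"
proof (rule ereal_le_epsilon2)
  fix e :: real assume "0 < e"
  then show "asym_fun X c \<le> ereal a + ereal e"
    using assms[of e] unfolding asym_fun_def by (intro Limsup_bounded) auto
qed

lemma asym_fun_less_eventually:
  assumes "asym_fun X c = ereal a" "0 < e"
  shows "eventually (\<lambda>n. (dist c (X n))\<^sup>2 < a + e) sequentially"
proof -
  have "asym_fun X c < ereal (a + e)"
    using assms by simp
  from Limsup_lessD[OF this[unfolded asym_fun_def]] show ?thesis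
    by simp
qed

lemma asym_fun_real:
  fixes X :: "nat \<Rightarrow> 'a::metric_space"
  assumes "bounded (range X)"
  obtains a where "asym_fun X c = ereal a" "0 \<le> a"
proof -
  obtain B where B: "\<And>n. dist c (X n) \<le> B"
    using assms bounded_any_center[of "range X" c] by auto
  have "asym_fun X c \<le> ereal (B\<^sup>2)"
    by (rule asym_fun_le) (use B in \<open>auto intro!: always_eventually add_increasing2 power_mono\<close>)
  moreover have "0 \<le> asym_fun X c"
    unfolding asym_fun_def by (rule le_Limsup) (auto simp: always_eventually)
  ultimately show ?thesis
    by (cases "asym_fun X c") (auto intro: that)
qed

lemma asym_fun_limit:
  assumes "(\<lambda>n. dist c (X n)) \<longlonglongrightarrow> l"
  shows "asym_fun X c = ereal (l\<^sup>2)"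
  unfolding asym_fun_def
  by (rule lim_imp_Limsup) (use assms in \<open>auto intro!: tendsto_intros\<close>)

text \<open>Serves two purposes: a constant \<open>e\<close> shows how the asymptotic function
  varies with its argument, and an \<open>e\<close> tending to 0 shows that \<open>c\<close> is
  asymptotically no farther than \<open>c'\<close>.\<close>

lemma asym_fun_le_add:
  fixes X :: "nat \<Rightarrow> 'a::metric_space"
  assumes e: "e \<longlonglongrightarrow> d" "\<And>n. 0 \<le> e n" and B: "\<And>n. dist c (X n) \<le> B"
    and le: "\<And>n. dist c (X n) \<le> dist c' (X n) + e n"
    and a: "asym_fun X c' = ereal a"
  shows "asym_fun X c \<le> ereal (a + 2 * B * d)"
proof (rule asym_fun_le)
  fix \<epsilon> :: real assume \<epsilon>: "0 < \<epsilon>"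
  have "(\<lambda>n. 2 * B * e n) \<longlonglongrightarrow> 2 * B * d"
    by (intro tendsto_intros e)
  then have "eventually (\<lambda>n. 2 * B * e n < 2 * B * d + \<epsilon> / 2) sequentially"
    using \<epsilon> by (intro order_tendstoD(2)) auto
  moreover have "eventually (\<lambda>n. (dist c' (X n))\<^sup>2 < a + \<epsilon> / 2) sequentially"
    using a \<epsilon> by (intro asym_fun_less_eventually) auto
  ultimately show "eventually (\<lambda>n. (dist c (X n))\<^sup>2 \<le> a + 2 * B * d + \<epsilon>) sequentially"
  proof eventually_elim
    case (elim n)
    have "(dist c (X n))\<^sup>2 \<le> (dist c' (X n))\<^sup>2 + 2 * dist c (X n) * e n"
    \<comment> \<open>The inequality \<open>dist c (X n) - e n \<le> dist c' (X n)\<close> may be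
      squared only if its left side is nonnegative; otherwise \<open>(dist c (X n))\<^sup>2\<close>
      is already below \<open>dist c (X n) * e n\<close>.\<close>
    proof (cases "e n \<le> dist c (X n)")
      case True
      then have "(dist c (X n) - e n)\<^sup>2 \<le> (dist c' (X n))\<^sup>2"
        using le[of n] by (intro power_mono) auto
      then show ?thesis
        using zero_le_power2[of "e n"] unfolding power2_diff by linarith
    next
      case False
      then have "(dist c (X n))\<^sup>2 \<le> dist c (X n) * e n"
        unfolding power2_eq_square by (intro mult_left_mono) auto
      moreover have "0 \<le> dist c (X n) * e n" "0 \<le> (dist c' (X n))\<^sup>2"
        using e(2)[of n] by auto
      ultimately show ?thesis
        by linarith
    qed
    also have "2 * dist c (X n) * e n \<le> 2 * B * e n"
      using B[of n] e(2)[of n] by (intro mult_right_mono) auto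
    finally show ?case
      using elim by linarith
  qed
qed

lemma asym_fun_midpoint:
  fixes X :: "nat \<Rightarrow> 'a::hadamard_space"
  assumes "asym_fun X x = ereal a" "asym_fun X y = ereal b"
  shows "asym_fun X (geo_comb (1 / 2) x y) \<le> ereal ((a + b) / 2 - (dist x y)\<^sup>2 / 4)"
proof (rule asym_fun_le)
  fix e :: real assume e: "0 < e"
  show "eventually (\<lambda>n. (dist (geo_comb (1 / 2) x y) (X n))\<^sup>2 \<le> (a + b) / 2 - (dist x y)\<^sup>2 / 4 + e)
    sequentially"
    using asym_fun_less_eventually[OF assms(1) e] asym_fun_less_eventually[OF assms(2) e]
  proof eventually_elim
    case (elim n)
    then show ?case
      using geo_comb_CN[of "1 / 2" "X n" x y] by (simp add: dist_commute field_simps)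
  qed
qed

text \<open>Uniform convexity, from the midpoint estimate, makes a minimizing sequence Cauchy; its
  limit attains the infimum by continuity of the asymptotic function.\<close>

lemma asymptotic_center_exists:
  fixes X :: "nat \<Rightarrow> 'a::hadamard_space"
  assumes X: "bounded (range X)"
  shows "\<exists>c. is_asymptotic_center X c"
proof -
  obtain f where f: "\<And>c. asym_fun X c = ereal (f c)" "\<And>c. 0 \<le> f c"
  proof -
    have "\<forall>c. \<exists>a. asym_fun X c = ereal a \<and> 0 \<le> a"
      using asym_fun_real[OF X] by blast
    from choice[OF this] show thesis
      using that by blast
  qed
  define I where "I = Inf (range f)"
  have bdd: "bdd_below (range f)"
    using f(2) by (rule bdd_belowI2)
  have I: "I \<le> f c" for c
    unfolding I_def using bdd by (auto intro: cInf_lower)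
  \<comment> \<open>The midpoint has value at least \<open>I\<close> but at most
    \<open>I + e - (dist x y)\<^sup>2 / 4\<close>.\<close>
  have near: "(dist x y)\<^sup>2 \<le> 4 * e" if "f x \<le> I + e" "f y \<le> I + e" for x y e
    using asym_fun_midpoint[OF f(1) f(1), of x y] I[of "geo_comb (1 / 2) x y"] that
    by (simp add: f(1) field_simps)
  have "\<exists>c. f c \<le> I + 1 / real (Suc k)" for k
  proof -
    have "Inf (range f) < I + 1 / real (Suc k)"
      by (simp add: I_def)
    from cInf_lessD[OF _ this] show ?thesis
      by (auto intro: less_imp_le)
  qed
  then obtain c where c: "\<And>k. f (c k) \<le> I + 1 / real (Suc k)"
    by metis
  have "Cauchy c"
  proof (rule metric_CauchyI)
    fix e :: real assume e: "0 < e"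
    then have "0 < e\<^sup>2 / 4"
      by simp
    then obtain N where N: "inverse (real (Suc N)) < e\<^sup>2 / 4"
      using reals_Archimedean by blast
    have "dist (c m) (c n) < e" if "m \<ge> N" "n \<ge> N" for m n
    proof -
      have *: "f (c k) \<le> I + 1 / real (Suc N)" if "k \<ge> N" for k
      proof -
        have "1 / real (Suc k) \<le> 1 / real (Suc N)"
          using that by (intro divide_left_mono) auto
        with c[of k] show ?thesis
          by linarith
      qed
      have "(dist (c m) (c n))\<^sup>2 \<le> 4 * (1 / real (Suc N))"
        by (rule near) (use * that in auto)
      also have "\<dots> < e\<^sup>2"
        using N by (simp add: inverse_eq_divide)
      finally show ?thesis
        using e by (auto intro: power2_less_imp_less)
    qed
    then show "\<exists>M. \<forall>m\<ge>M. \<forall>n\<ge>M. dist (c m) (c n) < e"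
      by blast
  qed
  then obtain z where z: "c \<longlonglongrightarrow> z"
    using Cauchy_convergent convergent_def by blast
  obtain B where B: "\<And>n. dist z (X n) \<le> B"
    using X bounded_any_center[of "range X" z] by auto
  have "f z \<le> f y + 2 * B * dist z y" for y
    using asym_fun_le_add[OF tendsto_const[of "dist z y"] _ B _ f(1)[of y]] f(1)[of z]
    by (simp add: dist_triangle add.commute)
  then have "f z \<le> I + 1 / real (Suc k) + 2 * B * dist z (c k)" for k
  proof -
    have "f z \<le> f (c k) + 2 * B * dist z (c k)"
      by fact
    with c[of k] show ?thesis
      by linarith
  qed
  moreover have "(\<lambda>k. I + 1 / real (Suc k) + 2 * B * dist z (c k)) \<longlonglongrightarrow> I + 0 + 2 * B * dist z z"
    by (intro tendsto_intros z LIMSEQ_Suc[OF lim_const_over_n])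
  ultimately have "f z \<le> I"
    by (auto intro: LIMSEQ_le_const)
  then have min: "(\<forall>w. asym_fun X y \<le> asym_fun X w) \<longleftrightarrow> f y = I" for y
    unfolding f(1) ereal_less_eq using I by (metis antisym order_trans)
  \<comment> \<open>Uniqueness is \<open>near\<close> with \<open>e = 0\<close>.\<close>
  have "f y = I \<longleftrightarrow> y = z" for y
    using near[of y 0 z] I[of z] \<open>f z \<le> I\<close> by auto
  then have "is_asymptotic_center X z"
    unfolding is_asymptotic_center_def min by simp
  then show ?thesis ..
qed

lemma asymptotic_center_le:
  "is_asymptotic_center X c \<Longrightarrow> asym_fun X c \<le> asym_fun X y"
  unfolding is_asymptotic_center_def by auto

lemma asymptotic_center_unique:
  assumes "is_asymptotic_center X c" "asym_fun X y \<le> asym_fun X c"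
  shows "y = c"
proof -
  have "y \<in> {y. \<forall>w. asym_fun X y \<le> asym_fun X w}"
    using assms(2) asymptotic_center_le[OF assms(1)] by (auto intro: order_trans)
  then show ?thesis
    using assms(1) unfolding is_asymptotic_center_def by auto
qed


section \<open>Weak convergence of the semigroup\<close>

context nonexpansive_map
begin

text \<open>A nonincreasing function bounded below tends to its infimum, here taken over nonnegative
  times only.\<close>

lemma dist_fixed_point_semigroup_gen_tendsto:
  assumes p: "F p = p"
  shows "\<exists>l. ((\<lambda>t. dist p (semigroup_gen F t x)) \<longlongrightarrow> l) at_top"
proof -
  let ?g = "\<lambda>t. dist p (semigroup_gen F t x)"
  define l where "l = Inf (?g ` {0..})"
  have bdd: "bdd_below (?g ` {0..})"
    by (rule bdd_belowI2[of _ 0]) simp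
  have "(?g \<longlongrightarrow> l) at_top"
  proof (rule order_tendstoI)
    fix a assume "a < l"
    moreover have "l \<le> ?g t" if "0 \<le> t" for t
      unfolding l_def using bdd that by (intro cInf_lower) auto
    ultimately show "eventually (\<lambda>t. a < ?g t) at_top"
      by (intro eventually_at_top_linorderI[of 0]) (auto intro: less_le_trans)
  next
    fix a assume "l < a"
    then obtain s where s: "0 \<le> s" "?g s < a"
      using cInf_lessD[of "?g ` {0..}" a] unfolding l_def by auto
    then show "eventually (\<lambda>t. ?g t < a) at_top"
      using dist_fixed_point_semigroup_gen_antimono[OF s(1) _ p]
      by (intro eventually_at_top_linorderI[of s]) (auto intro: le_less_trans)
  qed
  then show ?thesis ..
qed

lemma bounded_semigroup_gen:
  assumes "F p = p" "\<And>n. 0 \<le> t n"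
  shows "bounded (range (\<lambda>n. semigroup_gen F (t n) x))"
  using dist_fixed_point_semigroup_gen_le[OF assms(2,1)]
  unfolding bounded_def by (intro exI[of _ p]) auto

text \<open>The displacements \<open>e n\<close> vanish since \<open>t n * (e n)\<^sup>2\<close> is
  bounded. Hence \<open>F c\<close> is asymptotically no farther from the sequence than
  \<open>c\<close>, and uniqueness of the center forces equality.\<close>

lemma F_asymptotic_center:
  assumes p: "F p = p" and t: "\<And>n. 0 \<le> t n" "filterlim t at_top sequentially"
    and c: "is_asymptotic_center (\<lambda>n. semigroup_gen F (t n) x) c"
  shows "F c = c"
proof -
  let ?X = "\<lambda>n. semigroup_gen F (t n) x"
  define e where "e n = dist (?X n) (F (?X n))" for n
  have bdd: "bounded (range ?X)"
    using p t(1) by (rule bounded_semigroup_gen)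
  obtain a where a: "asym_fun ?X c = ereal a"
    using asym_fun_real[OF bdd] by metis
  obtain B where B: "\<And>n. dist (F c) (?X n) \<le> B"
    using bdd bounded_any_center[of "range ?X" "F c"] by auto
  have "(\<lambda>n. (dist p x)\<^sup>2 / t n) \<longlonglongrightarrow> 0"
    using t(2) by (intro real_tendsto_divide_at_top[OF tendsto_const])
  moreover have "eventually (\<lambda>n. (e n)\<^sup>2 \<le> (dist p x)\<^sup>2 / t n) sequentially"
    using filterlim_at_top_dense[THEN iffD1, OF t(2), rule_format, of 0]
  proof eventually_elim
    case (elim n)
    then show ?case
      using dist_F_semigroup_gen[OF t(1) p, of n x] by (simp add: e_def field_simps)
  qed
  ultimately have "(\<lambda>n. (e n)\<^sup>2) \<longlonglongrightarrow> 0"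
    using tendsto_sandwich[OF always_eventually _ tendsto_const, of 0 "\<lambda>n. (e n)\<^sup>2"] by simp
  then have e: "e \<longlonglongrightarrow> 0"
    using tendsto_real_sqrt[of "\<lambda>n. (e n)\<^sup>2" 0] by (simp add: e_def[abs_def])
  have "dist (F c) (?X n) \<le> dist c (?X n) + e n" for n
    using dist_triangle[of "F c" "?X n" "F (?X n)"] nonexpansive[of c "?X n"]
    by (simp add: e_def dist_commute)
  from asym_fun_le_add[OF e _ B this a] have "asym_fun ?X (F c) \<le> asym_fun ?X c"
    by (simp add: e_def a)
  then show ?thesis
    by (rule asymptotic_center_unique[OF c])
qed

end

theorem theorem1p6:
  fixes F :: "'a::hadamard_space \<Rightarrow> 'a" and x0 :: 'a
  assumes nonexpansive: "\<And>x y. dist (F x) (F y) \<le> dist x y"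
    and fixed_point: "\<exists>p. F p = p"
  shows "\<exists>z. F z = z \<and> weakly_converges_at_top (\<lambda>t. semigroup_gen F t x0) z"
proof -
  interpret nonexpansive_map F
    by unfold_locales (rule nonexpansive)
  obtain p where p: "F p = p"
    using fixed_point by blast
  let ?u = "\<lambda>t. semigroup_gen F t x0"
  obtain l where l: "\<And>q. F q = q \<Longrightarrow> ((\<lambda>t. dist q (?u t)) \<longlongrightarrow> l q) at_top"
  proof -
    have "\<forall>q. \<exists>l. F q = q \<longrightarrow> ((\<lambda>t. dist q (?u t)) \<longlongrightarrow> l) at_top"
      using dist_fixed_point_semigroup_gen_tendsto by blast
    from choice[OF this] show thesis
      using that by blast
  qed
  have center: "\<exists>c. is_asymptotic_center (\<lambda>n. ?u (t n)) c \<and> F c = c"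
    if "\<And>n. 0 \<le> t n" "filterlim t at_top sequentially" for t :: "nat \<Rightarrow> real"
    using asymptotic_center_exists[OF bounded_semigroup_gen[of p t x0, OF p that(1)]]
      F_asymptotic_center[OF p that] by blast
  \<comment> \<open>At a fixed point the value is the same for every sequence of times, which
    permits centers of different sequences to be compared.\<close>
  have asym: "asym_fun (\<lambda>n. ?u (t n)) q = ereal ((l q)\<^sup>2)"
    if "filterlim t at_top sequentially" "F q = q" for t :: "nat \<Rightarrow> real" and q
    using filterlim_compose[OF l[OF that(2)] that(1)] by (rule asym_fun_limit)
  have real_lim: "filterlim real at_top sequentially"
    by (rule filterlim_real_sequentially)
  \<comment> \<open>The integer times serve as reference sequence and supply the candidate for the
    weak limit.\<close>
  obtain z where z: "is_asymptotic_center (\<lambda>n. ?u (real n)) z" "F z = z"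
    using center[OF _ real_lim] by auto
  have main: "is_asymptotic_center (\<lambda>n. ?u (t n)) z"
    if t: "\<And>n. 0 \<le> t n" "filterlim t at_top sequentially" for t
  proof -
    obtain c where c: "is_asymptotic_center (\<lambda>n. ?u (t n)) c" "F c = c"
      using center[OF t] by blast
    have "asym_fun (\<lambda>n. ?u (t n)) c \<le> asym_fun (\<lambda>n. ?u (t n)) z"
      by (rule asymptotic_center_le[OF c(1)])
    \<comment> \<open>Both \<open>c\<close> and \<open>z\<close> are fixed points, so the inequality
      carries over from the times \<open>t n\<close> to the reference times, where \<open>z\<close>
      is the unique minimizer.\<close>
    then have "asym_fun (\<lambda>n. ?u (real n)) c \<le> asym_fun (\<lambda>n. ?u (real n)) z"
      using asym[OF t(2)] asym[OF real_lim] c(2) z(2) by simp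
    then have "c = z"
      by (rule asymptotic_center_unique[OF z(1)])
    with c show ?thesis
      by simp
  qed
  have "weakly_converges_at_top ?u z"
    unfolding weakly_converges_at_top_def weakly_converges_def
  proof (intro allI impI conjI)
    fix t :: "nat \<Rightarrow> real" and r :: "nat \<Rightarrow> nat"
    assume t: "(\<forall>n. 0 \<le> t n) \<and> filterlim t at_top sequentially"
    then show "bounded (range (\<lambda>n. ?u (t n)))"
      by (intro bounded_semigroup_gen[OF p]) auto
    assume "strict_mono r"
    \<comment> \<open>A subsequence of the orbit is the orbit along times that again tend to
      infinity, so \<open>main\<close> covers it.\<close>
    then have "filterlim (\<lambda>n. t (r n)) at_top sequentially"
      using t filterlim_subseq filterlim_compose by blast
    with t show "is_asymptotic_center ((\<lambda>n. ?u (t n)) \<circ> r) z"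
      using main[of "\<lambda>n. t (r n)"] by (simp add: o_def)
  qed
  with z(2) show ?thesis
    by blast
qed

end
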